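(* The rational normal curve is the only polynomial curve, up to affine isomorphism, whose hodograph has a constant nonzero Wronskian. That is: (a) for the parametrization $\boldsymbol{u}(t)=(t,t^2,\ldots,t^n)$ of the rational normal curve in $\mathbb{K}^n$, the Wronskian of $\boldsymbol{u}'(t)$ is a nonzero constant; and (b) if $\boldsymbol{x}(t)=(x_1(t),\ldots,x_n(t))$ with $x_i(t)\in\mathbb{K}[t]$ is a polynomially parametrized curve in $\mathbb{K}^n$ such that the Wronskian of its hodograph $\boldsymbol{x}'(t)$ is a nonzero constant, then there exist a nonsingular $n\times n$ matrix $A$ over $\mathbb{K}$ and $\boldsymbol{b}\in\mathbb{K}^n$ such that $\boldsymbol{x}(t)=A\boldsymbol{u}(t)+\boldsymbol{b}$.
   Context: $\mathbb{K}$ is a field of characteristic zero, $n$ is a positive integer. The rational normal curve in $\mathbb{K}^n$ is the curve parametrized by $\boldsymbol{u}(t)=(t,t^2,\ldots,t^n)$. The hodograph of a parametrization $\boldsymbol{x}(t)$ is its first derivative $\boldsymbol{x}'(t)$. The Wronskian of $\boldsymbol{y}(t)=(y_1(t),\ldots,y_n(t))$ is $\det(\boldsymbol{y}(t),\boldsymbol{y}'(t),\ldots,\boldsymbol{y}^{(n-1)}(t))$, the determinant of the $n\times n$ matrix with these vectors as rows; so the Wronskian of the hodograph of $\boldsymbol{x}(t)$ is $\det(\boldsymbol{x}'(t),\boldsymbol{x}''(t),\ldots,\boldsymbol{x}^{(n)}(t))$. *)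

theory Defs
  imports "Jordan_Normal_Form.Determinant" "HOL-Computational_Algebra.Polynomial"
begin

text \<open>A polynomially parametrized curve in \<open>K\<^sup>n\<close> is a vector in \<^term>\<open>carrier_vec n\<close> with entries
  in \<open>K[t]\<close>. Coordinates are indexed from 0 to \<open>n - 1\<close>.\<close>

definition rational_normal_curve :: "nat \<Rightarrow> 'a::field_char_0 poly vec" where
  "rational_normal_curve n = vec n (\<lambda>i. monom 1 (Suc i))"

definition hodograph :: "'a::field_char_0 poly vec \<Rightarrow> 'a poly vec" where
  "hodograph x = map_vec pderiv x"

definition wronskian :: "'a::field_char_0 poly vec \<Rightarrow> 'a poly" where
  "wronskian y =
     det (mat_of_rows (dim_vec y) (map (\<lambda>i. map_vec (pderiv ^^ i) y) [0..<dim_vec y]))"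

definition nonzero_constant :: "'a::field_char_0 poly \<Rightarrow> bool" where
  "nonzero_constant p \<longleftrightarrow> (\<exists>c. c \<noteq> 0 \<and> p = [:c:])"

definition affine_image :: "'a::field_char_0 mat \<Rightarrow> 'a vec \<Rightarrow> 'a poly vec \<Rightarrow> 'a poly vec" where
  "affine_image A b x = map_mat (\<lambda>c. [:c:]) A *\<^sub>v x + map_vec (\<lambda>c. [:c:]) b"

end

theory Submission imports Defs begin

text \<open>
  Part (a) is a triangular determinant. For part (b) put \<open>y = x'\<close>; the point is that a constant nonzero
  Wronskian forces every entry of \<open>y\<close> to have degree less than \<open>n\<close> (\<open>degree_less_if_wronskian_constant\<close>).
  Subtracting a constant multiple of one entry of \<open>y\<close> from another does not change the Wronskian, so
  one may cancel leading terms until the degrees \<open>d\<^sub>0, \<dots>, d\<^bsub>n-1\<^esub>\<close> of the entries are pairwise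
  distinct. Multiplying the \<open>j\<close>-th derivatives by \<open>t\<^sup>j\<close> turns the Wronskian \<open>c\<close> into
  \<open>c t\<^bsup>0 + 1 + \<dots> + (n-1)\<^esup>\<close>, while differentiation followed by this multiplication acts diagonally on monomials:
  it sends \<open>t\<^sup>d\<close> to \<open>d (d-1) \<dots> (d-j+1) t\<^sup>d\<close>. Hence the coefficient of this determinant at
  \<open>t\<^bsup>d\<^sub>0 + \<dots> + d\<^sub>n\<^sub>-\<^sub>1\<^esup>\<close> is the product of the leading coefficients times a
  determinant of falling factorials, a disguised Vandermonde determinant, which is nonzero for distinct \<open>d\<^sub>i\<close>
  in characteristic zero. So \<open>n\<close> distinct natural numbers have the sum
  \<open>0 + 1 + \<dots> + (n-1)\<close>, which is only possible if they are \<open>0, \<dots>, n-1\<close>.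

  Once the entries of \<open>x'\<close> have degree less than \<open>n\<close>, the coefficients of \<open>x\<close> give \<open>A\<close> and \<open>b\<close> with
  \<open>x = A u + b\<close>, and the Wronskian of \<open>x'\<close> is \<open>det A\<close> times that of \<open>u'\<close>; so \<open>det A \<noteq> 0\<close>.
\<close>

section \<open>Wronskians under constant linear changes of coordinates\<close>

text \<open>The transpose of the matrix that defines the Wronskian: constant linear maps act on
  it by multiplication from the left.\<close>

definition wronskian_mat :: "nat \<Rightarrow> 'a::field_char_0 poly vec \<Rightarrow> 'a poly mat" where
  "wronskian_mat n y = mat n n (\<lambda>(i, j). (pderiv ^^ j) (y $ i))"

lemma wronskian_mat_carrier [simp]: "wronskian_mat n y \<in> carrier_mat n n"
  by (simp add: wronskian_mat_def)

lemma wronskian_mat_dim [simp]: "dim_row (wronskian_mat n y) = n" "dim_col (wronskian_mat n y) = n"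
  by (simp_all add: wronskian_mat_def)

lemma wronskian_eq_det:
  assumes "y \<in> carrier_vec n"
  shows "wronskian y = det (wronskian_mat n y)"
proof -
  have "mat_of_rows (dim_vec y) (map (\<lambda>i. map_vec (pderiv ^^ i) y) [0..<dim_vec y])
      = transpose_mat (wronskian_mat n y)"
    using assms by (intro eq_matI) (auto simp: wronskian_mat_def mat_of_rows_def)
  then show ?thesis
    by (simp add: wronskian_def det_transpose[OF wronskian_mat_carrier])
qed

lemma wronskian_linear_map:
  fixes A :: "'a::field_char_0 mat"
  assumes A: "A \<in> carrier_mat n n" and y: "y \<in> carrier_vec n"
  shows "wronskian (map_mat (\<lambda>c. [:c:]) A *\<^sub>v y) = [:det A:] * wronskian y"
proof -
  let ?C = "map_mat (\<lambda>c. [:c:]) A"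
  interpret const: comm_ring_hom "\<lambda>c::'a. [:c:]"
    by unfold_locales (auto simp: one_pCons)
  have "(pderiv ^^ j) ((?C *\<^sub>v y) $ i) = (?C * wronskian_mat n y) $$ (i, j)"
    if "i < n" "j < n" for i j
    using that A y
    by (simp add: scalar_prod_def wronskian_mat_def higher_pderiv_sum higher_pderiv_smult)
  then have "wronskian_mat n (?C *\<^sub>v y) = ?C * wronskian_mat n y"
    using A by (intro eq_matI) (auto simp: wronskian_mat_def)
  moreover have C: "?C \<in> carrier_mat n n" and Cy: "?C *\<^sub>v y \<in> carrier_vec n"
    using A y by auto
  ultimately show ?thesis
    by (simp only: wronskian_eq_det[OF Cy] wronskian_eq_det[OF y] const.hom_det
        det_mult[OF C wronskian_mat_carrier])
qed

lemma wronskian_subtract_multiple: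
  assumes y: "y \<in> carrier_vec n" and "i < n" "k < n" "i \<noteq> k"
  shows "wronskian (vec n (\<lambda>l. if l = i then y $ i - smult c (y $ k) else y $ l)) = wronskian y"
    (is "wronskian ?z = _")
proof -
  have diff: "(pderiv ^^ j) (p - smult c q) = [:-c:] * (pderiv ^^ j) q + (pderiv ^^ j) p"
    for j and p q :: "'a poly"
  proof -
    have "p - smult c q = p + smult (-c) q" by simp
    then show ?thesis by (simp only: higher_pderiv_add higher_pderiv_smult) simp
  qed
  have "wronskian_mat n ?z = addrow [:-c:] i k (wronskian_mat n y)"
    using assms by (intro eq_matI) (auto simp: wronskian_mat_def diff simp del: mult_pCons_left)
  then show ?thesis
    using assms det_addrow[of k n i "wronskian_mat n y" "[:-c:]"]
    by (simp add: wronskian_eq_det[of _ n])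
qed

lemma wronskian_zero_entry:
  assumes y: "y \<in> carrier_vec n" and i: "i < n" "y $ i = 0"
  shows "wronskian y = 0"
proof -
  have "wronskian_mat n y = mat\<^sub>r n n (\<lambda>l. if l = i then 0\<^sub>v n else row (wronskian_mat n y) l)"
    using i by (intro eq_matI) (auto simp: wronskian_mat_def)
  moreover have "det (mat\<^sub>r n n (\<lambda>l. if l = i then 0\<^sub>v n else row (wronskian_mat n y) l)) = 0"
    using i(1) by (rule det_row_0) (auto simp: wronskian_mat_def)
  ultimately show ?thesis
    by (simp only: wronskian_eq_det[OF y])
qed

section \<open>The leading coefficient of a Wronskian\<close>

text \<open>The eigenvalue of \<open>t\<^sup>j D\<^sup>j\<close> on \<open>t\<^sup>m\<close> is \<open>m (m-1) \<dots> (m-j+1)\<close>. Taking it as the value at \<open>m\<close> of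
  one polynomial covers the case \<open>m < j\<close>, where the derivative vanishes, and makes the root-counting
  argument for determinants of such eigenvalues available.\<close>

definition falling_factorial_poly :: "nat \<Rightarrow> 'a::field_char_0 poly" where
  "falling_factorial_poly j = (\<Prod>k<j. [:- of_nat k, 1:])"

lemma degree_falling_factorial_poly [simp]: "degree (falling_factorial_poly j) = j"
  by (simp add: falling_factorial_poly_def degree_prod_eq_sum_degree)

lemma coeff_monom_mult_higher_pderiv:
  "coeff (monom 1 j * (pderiv ^^ j) p) m
     = poly (falling_factorial_poly j) (of_nat m) * coeff p m"
proof (induction j)
  case 0
  then show ?case by (simp add: falling_factorial_poly_def)
next
  case (Suc j)
  have "coeff (monom 1 (Suc j) * (pderiv ^^ Suc j) p) m
      = (of_nat m - of_nat j) * coeff (monom 1 j * (pderiv ^^ j) p) m"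
  proof (cases "m \<le> j")
    case True
    then show ?thesis by (auto simp: coeff_monom_mult)
  next
    case False
    then have "Suc (m - Suc j) = m - j" by simp
    with False show ?thesis
      by (simp add: coeff_monom_mult coeff_pderiv of_nat_diff del: of_nat_Suc)
  qed
  then show ?case
    unfolding Suc.IH by (simp add: falling_factorial_poly_def algebra_simps)
qed

text \<open>A kernel vector of the matrix would be the coefficient vector of a nontrivial combination of the \<open>q j\<close> with
  degree less than \<open>n\<close> and \<open>n\<close> distinct roots. For \<open>q j = t\<^sup>j\<close> this is the Vandermonde determinant.\<close>

lemma det_poly_evaluations_nonzero:
  fixes q :: "nat \<Rightarrow> 'a::field poly" and a :: "nat \<Rightarrow> 'a"
  assumes deg: "\<And>j. degree (q j) = j" and nz: "q 0 \<noteq> 0" and inj: "inj_on a {..<n}"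
  shows "det (mat n n (\<lambda>(i, j). poly (q j) (a i))) \<noteq> 0" (is "det ?M \<noteq> 0")
proof
  assume "det ?M = 0"
  then obtain v where v: "v \<in> carrier_vec n" "v \<noteq> 0\<^sub>v n" "?M *\<^sub>v v = 0\<^sub>v n"
    using det_0_iff_vec_prod_zero_field[of ?M n] by auto
  define P where "P = (\<Sum>j<n. smult (v $ j) (q j))"
  have root: "poly P (a i) = 0" if "i < n" for i
  proof -
    have "poly P (a i) = (?M *\<^sub>v v) $ i"
      using that v(1)
      by (simp add: P_def poly_sum scalar_prod_def mult.commute atLeast0LessThan)
    with v(3) that show ?thesis by simp
  qed
  obtain j where j: "j < n" "v $ j \<noteq> 0" and max: "\<And>k. k < n \<Longrightarrow> v $ k \<noteq> 0 \<Longrightarrow> k \<le> j"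
  proof -
    let ?S = "{j. j < n \<and> v $ j \<noteq> 0}"
    have "\<exists>j<n. v $ j \<noteq> 0"
      using v(1,2) by (metis carrier_vecD eq_vecI index_zero_vec)
    then have "?S \<noteq> {}" "finite ?S" by auto
    then show ?thesis
      using Max_in[of ?S] Max_ge[of ?S] that[of "Max ?S"] by auto
  qed
  have lead: "coeff (q k) k \<noteq> 0" for k
  proof -
    have "q k \<noteq> 0" using nz deg[of k] by (metis degree_0)
    then show ?thesis using deg[of k] by (metis leading_coeff_0_iff)
  qed
  have "coeff P j = (\<Sum>k<n. if k = j then v $ j * coeff (q j) j else 0)"
    unfolding P_def coeff_sum coeff_smult
  proof (rule sum.cong)
    fix k assume "k \<in> {..<n}"
    then show "v $ k * coeff (q k) j = (if k = j then v $ j * coeff (q j) j else 0)"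
      using max[of k] deg[of k] by (cases "v $ k = 0") (auto intro!: coeff_eq_0)
  qed simp
  also have "\<dots> = v $ j * coeff (q j) j"
    using j by simp
  finally have "coeff P j \<noteq> 0"
    using j(2) lead[of j] by simp
  then have "P \<noteq> 0" by auto
  have "degree P < n"
    unfolding P_def using j(1) deg
    by (intro degree_sum_less) (auto intro: le_less_trans[OF degree_smult_le])
  moreover have "n \<le> card {x. poly P x = 0}"
  proof -
    have "a ` {..<n} \<subseteq> {x. poly P x = 0}" using root by auto
    then have "card (a ` {..<n}) \<le> card {x. poly P x = 0}"
      by (intro card_mono poly_roots_finite \<open>P \<noteq> 0\<close>)
    then show ?thesis by (simp add: card_image inj)
  qed
  ultimately show False
    using card_poly_roots_bound[OF \<open>P \<noteq> 0\<close>] by simp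
qed

lemma coeff_prod_degree_bounds:
  assumes "finite S" and "\<And>i. i \<in> S \<Longrightarrow> degree (f i) \<le> d i"
  shows "coeff (\<Prod>i\<in>S. f i) (\<Sum>i\<in>S. d i) = (\<Prod>i\<in>S. coeff (f i) (d i))
    \<and> degree (\<Prod>i\<in>S. f i) \<le> (\<Sum>i\<in>S. d i)"
  using assms
proof (induction S rule: finite_induct)
  case empty
  then show ?case by simp
next
  case (insert x S)
  let ?g = "\<Prod>i\<in>S. f i" and ?e = "\<Sum>i\<in>S. d i"
  have f: "degree (f x) \<le> d x" and g: "degree ?g \<le> ?e"
    and c: "coeff ?g ?e = (\<Prod>i\<in>S. coeff (f i) (d i))"
    using insert by auto
  have "coeff (f x * ?g) (d x + ?e) = (\<Sum>i\<le>d x + ?e. if i = d x then coeff (f x) (d x) * coeff ?g ?e else 0)"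
    unfolding coeff_mult
  proof (rule sum.cong)
    fix i
    show "coeff (f x) i * coeff ?g (d x + ?e - i)
        = (if i = d x then coeff (f x) (d x) * coeff ?g ?e else 0)"
    proof (cases i "d x" rule: linorder_cases)
      case less
      then have "coeff ?g (d x + ?e - i) = 0" using g by (intro coeff_eq_0) simp
      with less show ?thesis by simp
    next
      case greater
      then show ?thesis using f by (simp add: coeff_eq_0)
    qed simp
  qed simp
  moreover have "degree (f x * ?g) \<le> d x + ?e"
    using degree_mult_le[of "f x" ?g] f g by linarith
  ultimately show ?case
    using insert.hyps c by simp
qed

text \<open>In the Leibniz expansion every term takes one entry from each row, so the
  bound \<open>d i\<close> for row \<open>i\<close> makes all terms have degree at most \<open>\<Sum>i. d i\<close>, and leading coefficients can be taken entrywise.\<close>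

lemma coeff_det_row_degrees:
  fixes M :: "'a::idom poly mat"
  assumes M: "M \<in> carrier_mat n n"
    and deg: "\<And>i j. i < n \<Longrightarrow> j < n \<Longrightarrow> degree (M $$ (i, j)) \<le> d i"
  shows "coeff (det M) (\<Sum>i<n. d i) = det (mat n n (\<lambda>(i, j). coeff (M $$ (i, j)) (d i)))"
proof -
  have sign: "coeff (signof p * q) m = signof p * coeff q m" for p m and q :: "'a poly"
    by (simp add: sign_def)
  have perm: "p i < n" if "p permutes {0..<n}" "i < n" for p i
    using that by (metis atLeastLessThan_iff permutes_in_image zero_le)
  have "coeff (\<Prod>i = 0..<n. M $$ (i, p i)) (\<Sum>i<n. d i) = (\<Prod>i = 0..<n. coeff (M $$ (i, p i)) (d i))"
    if "p permutes {0..<n}" for p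
    using coeff_prod_degree_bounds[of "{0..<n}" "\<lambda>i. M $$ (i, p i)" d] deg perm[OF that]
    by (simp add: atLeast0LessThan)
  then show ?thesis
    using perm by (simp add: det_def'[OF M] det_def'[of _ n] coeff_sum sign)
qed

lemma sum_degrees_if_wronskian_constant:
  fixes y :: "'a::field_char_0 poly vec"
  assumes y: "y \<in> carrier_vec n" and W: "nonzero_constant (wronskian y)"
    and inj: "inj_on (\<lambda>i. degree (y $ i)) {..<n}"
  shows "(\<Sum>i<n. degree (y $ i)) = \<Sum>{..<n}"
proof -
  define d where "d i = degree (y $ i)" for i
  \<comment> \<open>Multiplication by \<open>D\<close> scales the column of \<open>j\<close>-th derivatives by \<open>t\<^sup>j\<close>, so that row \<open>i\<close> of the
    product has degree at most \<open>d i\<close> throughout and its coefficients there are explicit.\<close>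
  define D where "D = mat n n (\<lambda>(i, j). if i = j then monom (1::'a) j else 0)"
  define M where "M = wronskian_mat n y * D"
  obtain c where c: "c \<noteq> 0" "wronskian y = [:c:]"
    using W by (auto simp: nonzero_constant_def)
  have D: "D \<in> carrier_mat n n" by (simp add: D_def)
  have M: "M \<in> carrier_mat n n" unfolding M_def using D by (rule mult_carrier_mat[OF wronskian_mat_carrier])
  have entry: "M $$ (i, j) = monom 1 j * (pderiv ^^ j) (y $ i)" if "i < n" "j < n" for i j
  proof -
    have "M $$ (i, j) = (\<Sum>k = 0..<n. (pderiv ^^ k) (y $ i) * (if k = j then monom 1 j else 0))"
      using that by (simp add: M_def D_def wronskian_mat_def scalar_prod_def)
    also have "\<dots> = (\<Sum>k = 0..<n. if k = j then (pderiv ^^ j) (y $ i) * monom 1 j else 0)"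
      by (intro sum.cong) auto
    finally show ?thesis using that by (simp add: mult.commute)
  qed
  have "det D = (\<Prod>j = 0..<n. monom 1 j)"
  proof -
    have "upper_triangular D" "diag_mat D = map (monom 1) [0..<n]"
      by (auto simp: D_def diag_mat_def)
    then show ?thesis
      using det_upper_triangular[OF _ D] by (simp add: prod.distinct_set_conv_list[symmetric])
  qed
  also have "\<dots> = monom 1 (\<Sum>{..<n})"
    by (induction n) (auto simp: mult_monom add.commute)
  finally have det_M: "det M = monom c (\<Sum>{..<n})"
    using c y by (simp add: M_def det_mult[OF wronskian_mat_carrier D] wronskian_eq_det smult_monom)
  have "degree (M $$ (i, j)) \<le> d i" if "i < n" "j < n" for i j
    unfolding entry[OF that] d_def
    by (intro degree_le) (simp add: coeff_monom_mult_higher_pderiv coeff_eq_0)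
  then have "coeff (det M) (\<Sum>i<n. d i) = det (mat n n (\<lambda>(i, j). coeff (M $$ (i, j)) (d i)))"
    by (rule coeff_det_row_degrees[OF M])
  also have "mat n n (\<lambda>(i, j). coeff (M $$ (i, j)) (d i)) =
      mat n n (\<lambda>(i, j). if i = j then lead_coeff (y $ i) else 0) *
      mat n n (\<lambda>(i, j). poly (falling_factorial_poly j) (of_nat (d i)))" (is "_ = ?L * ?F")
  proof (rule eq_matI)
    fix i j assume "i < dim_row (?L * ?F)" "j < dim_col (?L * ?F)"
    then have ij: "i < n" "j < n" by auto
    then have "(?L * ?F) $$ (i, j) = (\<Sum>k = 0..<n. (if i = k then lead_coeff (y $ i) else 0) *
        poly (falling_factorial_poly j) (of_nat (d k)))"
      by (simp add: scalar_prod_def)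
    also have "\<dots> = (\<Sum>k = 0..<n. if k = i then lead_coeff (y $ i) *
        poly (falling_factorial_poly j) (of_nat (d i)) else 0)"
      by (intro sum.cong) auto
    finally show "mat n n (\<lambda>(i, j). coeff (M $$ (i, j)) (d i)) $$ (i, j) = (?L * ?F) $$ (i, j)"
      using ij by (simp add: entry coeff_monom_mult_higher_pderiv d_def mult.commute)
  qed auto
  also have "det (?L * ?F) = det ?L * det ?F"
    by (rule det_mult) auto
  also have "\<dots> \<noteq> 0"
  proof -
    have "diag_mat ?L = map (\<lambda>i. lead_coeff (y $ i)) [0..<n]"
      by (auto simp: diag_mat_def)
    moreover have "y $ i \<noteq> 0" if "i < n" for i
      using wronskian_zero_entry[OF y that] c by auto
    moreover have "upper_triangular ?L" by auto
    ultimately have "det ?L \<noteq> 0"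
      using det_upper_triangular[of ?L n] by (auto simp: prod_list_zero_iff)
    moreover have "inj_on (\<lambda>i. of_nat (d i) :: 'a) {..<n}"
      using inj by (auto simp: inj_on_def d_def)
    then have "det ?F \<noteq> 0"
      by (intro det_poly_evaluations_nonzero) (simp_all add: falling_factorial_poly_def[of 0])
    ultimately show ?thesis by simp
  qed
  finally show ?thesis
    unfolding det_M by (auto simp: d_def split: if_splits)
qed

section \<open>Constant Wronskian forces small degrees\<close>

text \<open>Exchanging the elements of \<open>S\<close> outside \<open>{..<n}\<close> for the missing ones inside keeps the cardinality and
  would strictly decrease the sum.\<close>

lemma finite_nat_set_eq_lessThan:
  fixes S :: "nat set"
  assumes S: "finite S" "card S = n" and sum: "\<Sum>S = \<Sum>{..<n}"
  shows "S = {..<n}"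
proof (rule ccontr)
  let ?T = "{..<n}"
  assume "S \<noteq> ?T"
  have card: "card (S - ?T) = card (?T - S)"
    using card_Diff_subset_Int[of S ?T] card_Diff_subset_Int[of ?T S] S by (simp add: Int_commute)
  have "S - ?T \<noteq> {}"
    using \<open>S \<noteq> ?T\<close> card_subset_eq[of ?T S] S by auto
  have "?T - S \<noteq> {}"
    using \<open>S - ?T \<noteq> {}\<close> card S by (metis card_0_eq card_eq_0_iff finite_Diff finite_lessThan)
  have "\<Sum>(?T - S) < (\<Sum>x\<in>?T - S. n)"
    using \<open>?T - S \<noteq> {}\<close> by (intro sum_strict_mono) auto
  also have "\<dots> = (\<Sum>x\<in>S - ?T. n)"
    using card by simp
  also have "\<dots> \<le> \<Sum>(S - ?T)"
    by (intro sum_mono) auto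
  finally have "\<Sum>(?T - S) < \<Sum>(S - ?T)" .
  moreover have "\<Sum>S = \<Sum>(S - ?T) + \<Sum>(S \<inter> ?T)" "\<Sum>?T = \<Sum>(?T - S) + \<Sum>(S \<inter> ?T)"
    using S sum.Int_Diff[of S id ?T] sum.Int_Diff[of ?T id S] by (auto simp: Int_commute)
  ultimately show False using sum by simp
qed

text \<open>Gaussian elimination on leading terms: while two degrees coincide, one of the two entries can be replaced by a
  combination of smaller degree. The replaced entry is recovered from the new ones, so bounds on the new
  degrees carry over to the old ones.\<close>

lemma degree_less_if_wronskian_constant:
  fixes y :: "'a::field_char_0 poly vec"
  assumes "y \<in> carrier_vec n" "nonzero_constant (wronskian y)" "l < n"
  shows "degree (y $ l) < n"
  using assms
proof (induction "\<Sum>i<n. degree (y $ i)" arbitrary: y l rule: less_induct)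
  case less
  note y = less.prems(1) and W = less.prems(2)
  show ?case
  proof (cases "inj_on (\<lambda>i. degree (y $ i)) {..<n}")
    case True
    have "(\<lambda>i. degree (y $ i)) ` {..<n} = {..<n}"
      using sum_degrees_if_wronskian_constant[OF y W True] True
      by (intro finite_nat_set_eq_lessThan) (auto simp: card_image sum.reindex)
    then show ?thesis using less.prems(3) by blast
  next
    case False
    then obtain i k where ik: "i < n" "k < n" "i \<noteq> k" "degree (y $ i) = degree (y $ k)"
      by (auto simp: inj_on_def)
    \<comment> \<open>No entry can become zero, so cancelling a leading term strictly lowers the degree even from degree 0.\<close>
    have nz: "z $ m \<noteq> 0" if "z \<in> carrier_vec n" "wronskian z = wronskian y" "m < n" for z m
      using wronskian_zero_entry[OF that(1,3)] that(2) W by (auto simp: nonzero_constant_def)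
    define c where "c = lead_coeff (y $ i) / lead_coeff (y $ k)"
    define z where "z = vec n (\<lambda>l. if l = i then y $ i - smult c (y $ k) else y $ l)"
    have z: "z \<in> carrier_vec n" by (simp add: z_def)
    have Wz: "wronskian z = wronskian y"
      unfolding z_def by (rule wronskian_subtract_multiple) (use y ik in auto)
    have zi: "z $ i = y $ i - smult c (y $ k)" using ik by (simp add: z_def)
    have "coeff (z $ i) (degree (y $ i)) = 0"
      using nz[OF y refl ik(2)] ik(4) by (simp add: zi c_def)
    then have "degree (z $ i) \<noteq> degree (y $ i)"
      using nz[OF z Wz ik(1)] by (metis leading_coeff_0_iff)
    moreover have "degree (z $ i) \<le> degree (y $ i)"
      unfolding zi using ik(4) by (intro degree_diff_le) auto
    ultimately have dec: "degree (z $ i) < degree (y $ i)" by simp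
    have "(\<Sum>m<n. degree (z $ m)) < (\<Sum>m<n. degree (y $ m))"
    proof (rule sum_strict_mono_ex1)
      show "\<forall>m\<in>{..<n}. degree (z $ m) \<le> degree (y $ m)"
        using dec by (auto simp: z_def)
      show "\<exists>m\<in>{..<n}. degree (z $ m) < degree (y $ m)"
        using dec ik(1) by blast
    qed simp
    then have IH: "degree (z $ m) < n" if "m < n" for m
      using less.hyps[of z m] z W Wz that by simp
    show ?thesis
    proof (cases "l = i")
      case True
      have "degree (y $ k) < n"
        using IH[of k] ik by (simp add: z_def)
      with True ik(4) show ?thesis by simp
    next
      case False
      then show ?thesis using IH[of l] less.prems(3) by (simp add: z_def)
    qed
  qed
qed

section \<open>The rational normal curve\<close>

lemma rational_normal_curve_carrier [simp]: "rational_normal_curve n \<in> carrier_vec n"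
  by (simp add: rational_normal_curve_def)

lemma hodograph_carrier [simp]: "hodograph x \<in> carrier_vec n \<longleftrightarrow> x \<in> carrier_vec n"
  by (simp add: hodograph_def)

lemma wronskian_hodograph_rational_normal_curve:
  "nonzero_constant (wronskian (hodograph (rational_normal_curve n :: 'a::field_char_0 poly vec)))"
proof -
  let ?u = "rational_normal_curve n :: 'a poly vec"
  let ?M = "wronskian_mat n (hodograph ?u)"
  have entry: "?M $$ (i, j) = (pderiv ^^ Suc j) (monom 1 (Suc i))" if "i < n" "j < n" for i j
    using that
    by (simp add: wronskian_mat_def hodograph_def rational_normal_curve_def funpow_Suc_right
        del: funpow.simps)
  \<comment> \<open>The entries with \<open>i < j\<close> vanish, so it is the transpose that is upper triangular.\<close>
  have "upper_triangular (transpose_mat ?M)"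
    by (auto simp: upper_triangular_def entry coeff_higher_pderiv
        simp del: funpow.simps intro!: poly_eqI)
  moreover have "diag_mat (transpose_mat ?M) = map (\<lambda>i. [:fact (Suc i):]) [0..<n]"
    by (auto simp: diag_mat_def entry coeff_higher_pderiv pochhammer_fact coeff_pCons
        simp del: funpow.simps fact_Suc intro!: poly_eqI split: nat.splits)
  ultimately have "wronskian (hodograph ?u) = prod_list (map (\<lambda>i. [:fact (Suc i):]) [0..<n])"
    using det_upper_triangular[of "transpose_mat ?M" n] det_transpose[of ?M n]
    by (simp add: wronskian_eq_det[of _ n])
  moreover have "nonzero_constant (prod_list (map (\<lambda>i. [:fact (Suc i)::'a:]) is))" for "is"
    by (induction "is") (auto simp: nonzero_constant_def one_pCons simp del: fact_Suc)
  ultimately show ?thesis by simp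
qed

lemma affine_image_rational_normal_curve_if_degree_le:
  fixes x :: "'a::field_char_0 poly vec"
  assumes x: "x \<in> carrier_vec n" and deg: "\<And>i. i < n \<Longrightarrow> degree (x $ i) \<le> n"
  shows "x = affine_image (mat n n (\<lambda>(i, j). coeff (x $ i) (Suc j))) (vec n (\<lambda>i. coeff (x $ i) 0))
    (rational_normal_curve n)" (is "x = ?y")
proof (rule eq_vecI)
  show "dim_vec x = dim_vec ?y" using x by (simp add: affine_image_def)
  fix i assume "i < dim_vec ?y"
  then have i: "i < n" by (simp add: affine_image_def)
  have "?y $ i = (\<Sum>j<n. monom (coeff (x $ i) (Suc j)) (Suc j)) + monom (coeff (x $ i) 0) 0"
    using i by (simp add: affine_image_def rational_normal_curve_def scalar_prod_def smult_monom
        monom_0 atLeast0LessThan)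
  also have "\<dots> = (\<Sum>j\<le>n. monom (coeff (x $ i) j) j)"
    by (simp add: sum.lessThan_Suc_shift lessThan_Suc_atMost[symmetric] add.commute
        del: sum.lessThan_Suc)
  also have "\<dots> = x $ i"
    using deg[OF i] by (rule poly_as_sum_of_monoms')
  finally show "x $ i = ?y $ i" by simp
qed

lemma hodograph_affine_image:
  assumes "A \<in> carrier_mat n n" "b \<in> carrier_vec n" "x \<in> carrier_vec n"
  shows "hodograph (affine_image A b x) = map_mat (\<lambda>c. [:c:]) A *\<^sub>v hodograph x"
  using assms
  by (intro eq_vecI)
    (auto simp: hodograph_def affine_image_def scalar_prod_def pderiv_add pderiv_smult
      pderiv_pCons higher_pderiv_sum[of 1, simplified])

lemma invertible_mat_if_det_nonzero:
  fixes A :: "'a::field mat"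
  assumes A: "A \<in> carrier_mat n n" and "det A \<noteq> 0"
  shows "invertible_mat A"
proof -
  obtain B where "B \<in> carrier_mat n n" "A * B = 1\<^sub>m n" "B * A = 1\<^sub>m n"
    using det_non_zero_imp_unit[OF assms, of "()"] by (auto simp: Units_def ring_mat_def)
  with A show ?thesis by (auto simp: invertible_mat_def inverts_mat_def)
qed

theorem theorem8:
  fixes n :: nat
  assumes "n \<ge> 1"
  shows "nonzero_constant
      (wronskian (hodograph (rational_normal_curve n :: 'a::field_char_0 poly vec))) \<and>
    (\<forall>x :: 'a poly vec. x \<in> carrier_vec n \<longrightarrow>
      nonzero_constant (wronskian (hodograph x)) \<longrightarrow>
      (\<exists>A b. A \<in> carrier_mat n n \<and> invertible_mat A \<and> b \<in> carrier_vec n \<and>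
         x = affine_image A b (rational_normal_curve n)))"
proof (intro conjI allI impI)
  show "nonzero_constant (wronskian (hodograph (rational_normal_curve n :: 'a poly vec)))"
    by (rule wronskian_hodograph_rational_normal_curve)
next
  fix x :: "'a poly vec"
  assume x: "x \<in> carrier_vec n" and W: "nonzero_constant (wronskian (hodograph x))"
  define A where "A = mat n n (\<lambda>(i, j). coeff (x $ i) (Suc j))"
  define b where "b = vec n (\<lambda>i. coeff (x $ i) 0)"
  have A: "A \<in> carrier_mat n n" and b: "b \<in> carrier_vec n"
    by (simp_all add: A_def b_def)
  have "degree (x $ i) \<le> n" if "i < n" for i
    using degree_less_if_wronskian_constant[of "hodograph x" n i] x W that
    by (simp add: hodograph_def degree_pderiv)
  then have x_eq: "x = affine_image A b (rational_normal_curve n)"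
    unfolding A_def b_def by (rule affine_image_rational_normal_curve_if_degree_le[OF x])
  have "wronskian (hodograph x) = [:det A:] * wronskian (hodograph (rational_normal_curve n))"
    by (subst x_eq) (simp add: hodograph_affine_image[OF A b] wronskian_linear_map[OF A]
        del: mult_pCons_left)
  with W have "det A \<noteq> 0"
    by (auto simp: nonzero_constant_def)
  then have "invertible_mat A"
    by (rule invertible_mat_if_det_nonzero[OF A])
  with A b x_eq show "\<exists>A b. A \<in> carrier_mat n n \<and> invertible_mat A \<and> b \<in> carrier_vec n \<and>
      x = affine_image A b (rational_normal_curve n)"
    by blast
qed

end
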